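(* Let $H$ be a polyomino graph with a perfect matching, and let $K$ be a maximal alternating set of $H$. Then $H-K$ has a unique perfect matching.
   Context: A polyomino graph is a connected finite subgraph of the infinite plane square grid such that each interior (finite) face is bounded by a unit square and each edge belongs to at least one such square. For a perfect matching $M$, a cycle is $M$-alternating if its edges alternate between edges in $M$ and edges not in $M$; a finite face is $M$-resonant if its boundary is $M$-alternating. A set of finite faces (not necessarily disjoint) is an alternating set if there is a perfect matching $M$ of $H$ such that all its faces are $M$-resonant; it is maximal if it is not properly contained in another alternating set of $H$. $H-K$ denotes the graph obtained by deleting all vertices lying on boundaries of faces in $K$ (the empty graph has exactly one perfect matching). *)

theory Defs
  imports "HOL-Analysis.Analysis"
begin

record 'v graph =
  verts :: "'v set"
  edges :: "'v set set"

definition graph_connected :: "'v graph \<Rightarrow> bool" where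
  "graph_connected G \<longleftrightarrow> verts G \<noteq> {} \<and>
     (\<forall>u\<in>verts G. \<forall>v\<in>verts G. (u, v) \<in> {(x, y). {x, y} \<in> edges G}\<^sup>*)"

definition perfect_matching :: "'v graph \<Rightarrow> 'v set set \<Rightarrow> bool" where
  "perfect_matching G M \<longleftrightarrow> M \<subseteq> edges G \<and> (\<forall>v\<in>verts G. \<exists>!e. e \<in> M \<and> v \<in> e)"

text \<open>A cycle is given by the list of its vertices in cyclic order; its \<open>i\<close>-th edge joins the
  \<open>i\<close>-th vertex to its cyclic successor.\<close>

definition cycle_edge :: "'v list \<Rightarrow> nat \<Rightarrow> 'v set" where
  "cycle_edge xs i = {xs ! (i mod length xs), xs ! (Suc i mod length xs)}"

definition cycle_edges :: "'v list \<Rightarrow> 'v set set" where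
  "cycle_edges xs = cycle_edge xs ` {..<length xs}"

definition is_cycle :: "'v graph \<Rightarrow> 'v list \<Rightarrow> bool" where
  "is_cycle G xs \<longleftrightarrow> length xs \<ge> 3 \<and> distinct xs \<and> set xs \<subseteq> verts G \<and> cycle_edges xs \<subseteq> edges G"

definition alternating_cycle :: "'v graph \<Rightarrow> 'v set set \<Rightarrow> 'v list \<Rightarrow> bool" where
  "alternating_cycle G M xs \<longleftrightarrow> is_cycle G xs \<and>
     (\<forall>i<length xs. cycle_edge xs i \<in> M \<longleftrightarrow> cycle_edge xs (Suc i) \<notin> M)"

type_synonym grid_graph = "(int \<times> int) graph"

definition grid_adj :: "int \<times> int \<Rightarrow> int \<times> int \<Rightarrow> bool" where
  "grid_adj u v \<longleftrightarrow> \<bar>fst u - fst v\<bar> + \<bar>snd u - snd v\<bar> = 1"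

definition grid_subgraph :: "grid_graph \<Rightarrow> bool" where
  "grid_subgraph H \<longleftrightarrow>
     (\<forall>e\<in>edges H. \<exists>u v. e = {u, v} \<and> u \<in> verts H \<and> v \<in> verts H \<and> grid_adj u v)"

definition pt :: "int \<times> int \<Rightarrow> real \<times> real" where
  "pt v = (real_of_int (fst v), real_of_int (snd v))"

text \<open>For an edge \<open>{u, v}\<close> the convex hull of its end points is the closed segment joining them.\<close>

definition edge_seg :: "(int \<times> int) set \<Rightarrow> (real \<times> real) set" where
  "edge_seg e = convex hull (pt ` e)"

definition drawing :: "grid_graph \<Rightarrow> (real \<times> real) set" where
  "drawing H = pt ` verts H \<union> (\<Union>e\<in>edges H. edge_seg e)"

definition finite_faces :: "grid_graph \<Rightarrow> (real \<times> real) set set" where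
  "finite_faces H = {F \<in> components (- drawing H). bounded F}"

definition bounded_by_unit_square :: "(real \<times> real) set \<Rightarrow> bool" where
  "bounded_by_unit_square F \<longleftrightarrow>
     (\<exists>i j. frontier F = frontier (cbox (pt (i, j)) (pt (i + 1, j + 1))))"

definition polyomino_graph :: "grid_graph \<Rightarrow> bool" where
  "polyomino_graph H \<longleftrightarrow>
     grid_subgraph H \<and> finite (verts H) \<and> graph_connected H \<and>
     (\<forall>F\<in>finite_faces H. bounded_by_unit_square F) \<and>
     (\<forall>e\<in>edges H. \<exists>F\<in>finite_faces H. edge_seg e \<subseteq> frontier F)"

definition boundary_edges :: "grid_graph \<Rightarrow> (real \<times> real) set \<Rightarrow> (int \<times> int) set set" where
  "boundary_edges H F = {e \<in> edges H. edge_seg e \<subseteq> frontier F}"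

definition resonant :: "grid_graph \<Rightarrow> (int \<times> int) set set \<Rightarrow> (real \<times> real) set \<Rightarrow> bool" where
  "resonant H M F \<longleftrightarrow>
     (\<exists>xs. cycle_edges xs = boundary_edges H F \<and> alternating_cycle H M xs)"

definition alternating_set :: "grid_graph \<Rightarrow> (real \<times> real) set set \<Rightarrow> bool" where
  "alternating_set H K \<longleftrightarrow> K \<subseteq> finite_faces H \<and>
     (\<exists>M. perfect_matching H M \<and> (\<forall>F\<in>K. resonant H M F))"

definition maximal_alternating_set :: "grid_graph \<Rightarrow> (real \<times> real) set set \<Rightarrow> bool" where
  "maximal_alternating_set H K \<longleftrightarrow>
     alternating_set H K \<and> \<not> (\<exists>K'. alternating_set H K' \<and> K \<subset> K')"

definition delete_verts :: "'v graph \<Rightarrow> 'v set \<Rightarrow> 'v graph" where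
  "delete_verts G S = \<lparr>verts = verts G - S, edges = {e \<in> edges G. e \<inter> S = {}}\<rparr>"

definition delete_faces :: "grid_graph \<Rightarrow> (real \<times> real) set set \<Rightarrow> grid_graph" where
  "delete_faces H K = delete_verts H {v \<in> verts H. \<exists>F\<in>K. pt v \<in> frontier F}"

end

theory Submission imports Defs begin

text \<open>
  Extend two perfect matchings of \<open>H - K\<close> by the same matching on the vertices of \<open>K\<close>, obtaining
  perfect matchings \<open>A\<close> and \<open>B\<close> of \<open>H\<close> for both of which all faces of \<open>K\<close> are resonant. If \<open>A \<noteq> B\<close>,
  the difference \<open>f\<close> of their height functions is a nonzero, finitely supported integer function on
  the unit cells which changes only across edges of \<open>H\<close>. After swapping \<open>A\<close> and \<open>B\<close> its maximum is
  positive, the cells where it is attained are faces of \<open>H\<close>, and walking along the extreme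
  staircase of these cells in a diagonal direction one meets a face that is resonant for \<open>A\<close> or for
  \<open>B\<close> and has a vertex where \<open>A\<close> and \<open>B\<close> differ. This face is not in \<open>K\<close> and can be added to it.
\<close>

section \<open>Height differences of grid matchings\<close>

text \<open>The sign of the two-colouring of the grid. The offset \<open>c\<close> makes a global
  change of sign expressible, which has the same effect as exchanging the two matchings.\<close>

definition checker :: "int \<Rightarrow> int \<Rightarrow> int \<Rightarrow> int" where
  "checker c i j = (if even (i + j + c) then 1 else - 1)"

text \<open>\<open>h i j\<close> and \<open>v i j\<close> say that the edge from \<open>(i, j)\<close> to \<open>(i + 1, j)\<close>, respectively to
  \<open>(i, j + 1)\<close>, is matched; \<open>P\<close> is the vertex set. A cell is indexed by its lower left corner.\<close>

definition grid_matching ::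
    "(int \<Rightarrow> int \<Rightarrow> bool) \<Rightarrow> (int \<Rightarrow> int \<Rightarrow> bool) \<Rightarrow> (int \<Rightarrow> int \<Rightarrow> bool) \<Rightarrow> bool" where
  "grid_matching P h v \<longleftrightarrow> (\<forall>i j. of_bool (h i j) + of_bool (h (i - 1) j) + of_bool (v i j)
     + of_bool (v i (j - 1)) = (of_bool (P i j) :: int))"

text \<open>With edges oriented from one colour to the other, \<open>A\<close> minus
  \<open>B\<close> is a flow without sources when both matchings cover the same vertices.
  \<open>f\<close> is its stream function on the cells; the equations give its jumps across the left
  and the bottom side of cell \<open>(i, j)\<close>.\<close>

definition height_difference :: "int \<Rightarrow> (int \<Rightarrow> int \<Rightarrow> bool) \<Rightarrow> (int \<Rightarrow> int \<Rightarrow> bool) \<Rightarrow>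
    (int \<Rightarrow> int \<Rightarrow> bool) \<Rightarrow> (int \<Rightarrow> int \<Rightarrow> bool) \<Rightarrow> (int \<Rightarrow> int \<Rightarrow> int) \<Rightarrow> bool" where
  "height_difference c hA vA hB vB f \<longleftrightarrow> (\<forall>i j.
     f i j - f (i - 1) j = checker c i j * (of_bool (vA i j) - of_bool (vB i j)) \<and>
     f i j - f i (j - 1) = - checker c i j * (of_bool (hA i j) - of_bool (hB i j)))"

lemma grid_matchingD:
  assumes "grid_matching P h v"
  shows "h i j \<Longrightarrow> \<not> h (i - 1) j \<and> \<not> v i j \<and> \<not> v i (j - 1)"
    and "h (i - 1) j \<Longrightarrow> \<not> v i j \<and> \<not> v i (j - 1)"
    and "v i j \<Longrightarrow> \<not> v i (j - 1)"
    and "P i j \<longleftrightarrow> h i j \<or> h (i - 1) j \<or> v i j \<or> v i (j - 1)"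
  using assms[unfolded grid_matching_def, rule_format, of i j]
  by (auto split: if_splits simp: of_bool_def)

lemma height_differenceD:
  assumes "height_difference c hA vA hB vB f"
  shows "f i j - f (i - 1) j = checker c i j * (of_bool (vA i j) - of_bool (vB i j))"
    and "f i j - f i (j - 1) = - checker c i j * (of_bool (hA i j) - of_bool (hB i j))"
  using assms unfolding height_difference_def by blast+

text \<open>The cells \<open>(a + k, b + k)\<close> for \<open>k \<le> p\<close> form a maximal run on the extreme diagonal of the set
  where \<open>f\<close> is maximal: their left edges lie in \<open>A\<close> only and their top edges in \<open>B\<close> only. If no cell
  is resonant, then \<open>A\<close> matches each of their lower right corners downwards, by induction from the
  upper end \<open>k = p\<close>, whereas \<open>B\<close> does not do so at \<open>k = 0\<close>; hence \<open>f\<close> exceeds its maximum at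
  \<open>(a + 1, b - 1)\<close>.\<close>

lemma staircase:
  fixes hA vA hB vB P :: "int \<Rightarrow> int \<Rightarrow> bool" and f :: "int \<Rightarrow> int \<Rightarrow> int" and a b c m :: int
    and p :: nat
  assumes mA: "grid_matching P hA vA"
    and mB: "grid_matching P hB vB"
    and ht: "height_difference c hA vA hB vB f"
    and ub: "\<And>i j. f i j \<le> m"
    and P: "\<And>i j. f i j = m \<Longrightarrow> P (i + 1) j"
    and diag: "\<And>i j. f i j = m \<Longrightarrow> j - i \<le> b - a"
    and par: "even (a + b + c)"
    and start: "f (a - 1) (b - 1) \<noteq> m"
    and stairs: "\<And>k. k \<le> p \<Longrightarrow> f (a + int k) (b + int k) = m"
    and stop: "f (a + int p + 1) (b + int p + 1) \<noteq> m"
  shows "\<exists>i j. f i j = m \<and>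
      (hA i j \<and> hA i (j + 1) \<or> vA i j \<and> vA (i + 1) j \<or>
       hB i j \<and> hB i (j + 1) \<or> vB i j \<and> vB (i + 1) j) \<and>
      (vA i j \<noteq> vB i j \<or> hA i (j + 1) \<noteq> hB i (j + 1))"
proof (rule ccontr)
  assume "\<not> ?thesis"
  then have no: "\<not> (hA i j \<and> hA i (j + 1))" "\<not> (vA i j \<and> vA (i + 1) j)"
      "\<not> (hB i j \<and> hB i (j + 1))" "\<not> (vB i j \<and> vB (i + 1) j)"
    if "f i j = m" "vA i j \<noteq> vB i j \<or> hA i (j + 1) \<noteq> hB i (j + 1)" for i j
    using that by blast+
  note uA = grid_matchingD[OF mA] and uB = grid_matchingD[OF mB]
  note fv = height_differenceD(1)[OF ht] and fh = height_differenceD(2)[OF ht]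
  have even: "checker c (a + k) (b + k) = 1" for k
    using par by (simp add: checker_def)
  have odd: "checker c (a + k) (b + k - 1) = -1" "checker c (a + k) (b + k + 1) = -1"
      "checker c (a + k - 1) (b + k) = -1" "checker c (a + k + 1) (b + k) = -1" for k
    using par by (auto simp: checker_def)
  \<comment> \<open>The neighbours to the left and above lie beyond the extreme diagonal, so
    \<open>f\<close> is smaller there. A jump is at most one, and its sign tells which matching owns
    the edge.\<close>
  have left: "vA (a + k) (b + k)" "\<not> vB (a + k) (b + k)" "f (a + k - 1) (b + k) = m - 1"
    and top: "hB (a + k) (b + k + 1)" "\<not> hA (a + k) (b + k + 1)" "f (a + k) (b + k + 1) = m - 1"
    if k: "f (a + k) (b + k) = m" for k
  proof -
    have "f (a + k - 1) (b + k) < m"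
      using diag[of "a + k - 1" "b + k"] ub[of "a + k - 1" "b + k"] by linarith
    then show "vA (a + k) (b + k)" "\<not> vB (a + k) (b + k)" "f (a + k - 1) (b + k) = m - 1"
      using fv[of "a + k" "b + k"] k by (auto simp: even of_bool_def split: if_splits)
    have "f (a + k) (b + k + 1) < m"
      using diag[of "a + k" "b + k + 1"] ub[of "a + k" "b + k + 1"] by linarith
    then show "hB (a + k) (b + k + 1)" "\<not> hA (a + k) (b + k + 1)" "f (a + k) (b + k + 1) = m - 1"
      using fh[of "a + k" "b + k + 1"] k by (auto simp: odd of_bool_def split: if_splits)
  qed
  have f0: "f a b = m" using stairs[of 0] by simp
  note left0 = left[of 0, simplified, OF f0] and top0 = top[of 0, simplified, OF f0]
  note odd0 = odd[of 0, simplified] and even0 = even[of 0, simplified]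
  \<comment> \<open>With the top side in \<open>B\<close>, a bottom side in \<open>B\<close> would
    make the cell resonant, while the left side in \<open>A\<close> keeps the bottom side out of
    \<open>A\<close>. So the cell below attains the maximum too.\<close>
  have nhB: "\<not> hB a b" using no(3)[OF f0] top0 left0 by auto
  have nhA: "\<not> hA a b" using uA(1)[of a b] left0 by auto
  have fdown: "f a (b - 1) = m" using fh[of a b] nhA nhB f0 by simp
  have Pab: "P a b" using uA(4)[of a b] left0 by auto
  \<comment> \<open>An edge of \<open>B\<close> leading left from the corner \<open>(a, b)\<close>
    would lift \<open>f\<close> to \<open>m\<close> on the preceding diagonal cell, against
    \<open>start\<close>. Hence \<open>B\<close> matches this corner downwards.\<close>
  have "\<not> hB (a - 1) b"
  proof
    assume *: "hB (a - 1) b"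
    have "\<not> hA (a - 1) b" using uA(2)[of a b] left0 by auto
    then have "f (a - 1) (b - 1) = m"
      using fh[of "a - 1" b] * odd0 left0 by simp
    with start show False by simp
  qed
  then have down: "vB a (b - 1)" using uB(4)[of a b] Pab nhB left0 by auto
  have nAdown: "\<not> vA a (b - 1)" using uA(3)[of a b] left0 by auto
  have q0: "\<not> vB (a + 1) (b - 1)" using no(4)[OF fdown] down nAdown by auto
  \<comment> \<open>The mirror image at the upper end, with the matchings exchanged:
    \<open>A\<close> matches the upper right corner of the last cell to the right.\<close>
  define r where "r = int p"
  have fr: "f (a + r) (b + r) = m" using stairs[of p] by (simp add: r_def)
  note leftr = left[OF fr] and topr = top[OF fr]
  have Pr: "P (a + r + 1) (b + r + 1)" using uB(4)[of "a + r + 1" "b + r + 1"] topr by auto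
  have nvA: "\<not> vA (a + r + 1) (b + r)" using no(2)[OF fr] leftr by auto
  have nvB: "\<not> vB (a + r + 1) (b + r)" using uB(2)[of "a + r + 1" "b + r + 1"] topr by auto
  have fright: "f (a + r + 1) (b + r) = m" using fv[of "a + r + 1" "b + r"] nvA nvB fr by simp
  have "\<not> vA (a + r + 1) (b + r + 1)"
  proof
    assume *: "vA (a + r + 1) (b + r + 1)"
    have "\<not> vB (a + r + 1) (b + r + 1)" using uB(2)[of "a + r + 1" "b + r + 1"] topr by auto
    then have "f (a + r + 1) (b + r + 1) = m"
      using fv[of "a + r + 1" "b + r + 1"] * even[of "r + 1"] topr by (simp add: add.assoc)
    with stop show False by (simp add: r_def)
  qed
  then have right: "hA (a + r + 1) (b + r + 1)"
    using uA(4)[of "a + r + 1" "b + r + 1"] Pr nvA topr by auto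
  have nBright: "\<not> hB (a + r + 1) (b + r + 1)" using uB(1)[of "a + r + 1" "b + r + 1"] topr by auto
  have qp: "\<not> hA (a + r + 1) (b + r)" using no(1)[OF fright] right nBright by auto
  \<comment> \<open>At the lower right corner of the \<open>k\<close>-th cell, the left sides of
    this cell and of the next one block the directions left and up for \<open>A\<close>, and the
    induction hypothesis blocks the direction right. For the last cell, \<open>nvA\<close> and
    \<open>qp\<close> block up and right.\<close>
  have q: "vA (a + int k + 1) (b + int k - 1)" if "k \<le> p" for k
    using that
  proof (induction "p - k" arbitrary: k)
    case 0
    then have [simp]: "int k = r" by (simp add: r_def)
    have "\<not> hA (a + r) (b + r)" using uA(1)[of "a + r" "b + r"] leftr by auto
    then show ?case
      using uA(4)[of "a + r + 1" "b + r"] P[OF fr] qp nvA by auto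
  next
    case (Suc d)
    have ih: "vA (a + int k + 2) (b + int k)" using Suc.hyps(1)[of "Suc k"] Suc.hyps(2)
      by (simp add: algebra_simps)
    have fk: "f (a + int k) (b + int k) = m" and fk1: "f (a + int k + 1) (b + int k + 1) = m"
      using stairs[of k] stairs[of "Suc k"] Suc.hyps(2) by (simp_all add: algebra_simps)
    have "vA (a + int k + 1) (b + int k + 1)"
      using left[of "int k + 1"] fk1 by (simp add: algebra_simps)
    then have 1: "\<not> vA (a + int k + 1) (b + int k)"
      using uA(3)[of "a + int k + 1" "b + int k + 1"] by auto
    have 2: "\<not> hA (a + int k) (b + int k)"
      using uA(1)[of "a + int k" "b + int k"] left[OF fk] by auto
    have 3: "\<not> hA (a + int k + 1) (b + int k)"
      using uA(2)[of "a + int k + 2" "b + int k"] ih by (auto simp: algebra_simps)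
    show ?case
      using uA(4)[of "a + int k + 1" "b + int k"] P[OF fk] 1 2 3 by auto
  qed
  \<comment> \<open>This edge is in \<open>A\<close> but not in \<open>B\<close>; crossing it from
    the maximal cell \<open>(a, b - 1)\<close> raises \<open>f\<close> once more.\<close>
  have "vA (a + 1) (b - 1)" using q[of 0] by simp
  moreover have "checker c (a + 1) (b - 1) = 1" using par by (simp add: checker_def)
  ultimately have "f (a + 1) (b - 1) = m + 1"
    using fv[of "a + 1" "b - 1"] q0 fdown by simp
  with ub[of "a + 1" "b - 1"] show False by simp
qed

section \<open>Existence and maximum of the height difference\<close>

text \<open>Summing the jumps across vertical edges along each row, from the left, defines
  \<open>f\<close>. The rule for horizontal edges follows by induction along the row, because the
  signed jumps around a vertex cancel. No edge is matched outside the box, so \<open>f\<close>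
  vanishes there.\<close>

lemma height_difference_exists:
  fixes hA vA hB vB P :: "int \<Rightarrow> int \<Rightarrow> bool" and L :: int
  assumes mA: "grid_matching P hA vA"
    and mB: "grid_matching P hB vB"
    and bound: "\<And>i j. P i j \<Longrightarrow> \<bar>i\<bar> \<le> L \<and> \<bar>j\<bar> \<le> L"
  obtains f :: "int \<Rightarrow> int \<Rightarrow> int"
  where "height_difference 0 hA vA hB vB f"
    and "\<And>i j. f i j \<noteq> 0 \<Longrightarrow> \<bar>i\<bar> \<le> L \<and> \<bar>j\<bar> \<le> L"
proof -
  define dv where "dv i j = checker 0 i j * (of_bool (vA i j) - of_bool (vB i j))" for i j
  define dh where "dh i j = - checker 0 i j * (of_bool (hA i j) - of_bool (hB i j))" for i j
  have none: "\<not> hA i j" "\<not> hA (i - 1) j" "\<not> vA i j" "\<not> vA i (j - 1)"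
    "\<not> hB i j" "\<not> hB (i - 1) j" "\<not> vB i j" "\<not> vB i (j - 1)" if "\<not> P i j" for i j
    using grid_matchingD(4)[OF mA, of i j] grid_matchingD(4)[OF mB, of i j] that by auto
  have out: "\<not> P i j" if "\<bar>i\<bar> > L \<or> \<bar>j\<bar> > L" for i j using bound[of i j] that by linarith
  have dv0: "dv i j = 0" if "\<bar>i\<bar> > L \<or> \<bar>j\<bar> > L \<or> \<bar>j + 1\<bar> > L" for i j
    using that none(3,7)[of i j] none(4,8)[of i "j + 1"] out[of i j] out[of i "j + 1"]
    by (auto simp: dv_def)
  have dh0: "dh i j = 0" if "\<bar>i\<bar> > L \<or> \<bar>i + 1\<bar> > L \<or> \<bar>j\<bar> > L" for i j
    using that none(1,5)[of i j] none(2,6)[of "i + 1" j] out[of i j] out[of "i + 1" j]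
    by (auto simp: dh_def)
  define f where "f i j = (\<Sum>k = - L..i. dv k j)" for i j
  have fv: "f i j - f (i - 1) j = dv i j" for i j
  proof (cases "i < - L")
    case True
    then have "\<bar>i\<bar> > L" by linarith
    then show ?thesis using True dv0[of i j] by (simp add: f_def)
  next
    case False
    then have "{- L..i} = insert i {- L..i - 1}" by auto
    then show ?thesis by (simp add: f_def)
  qed
  have f_left: "f i j = 0" if "i < - L" for i j using that by (simp add: f_def)
  \<comment> \<open>Both matchings cover the vertex \<open>(i, j)\<close> equally often, and its
    left and lower neighbours carry the opposite sign.\<close>
  have dd: "dh i j - dh (i - 1) j = dv i j - dv i (j - 1)" for i j
    using mA[unfolded grid_matching_def, rule_format, of i j]
      mB[unfolded grid_matching_def, rule_format, of i j]
    unfolding dh_def dv_def checker_def by (auto split: if_splits)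
  have fh: "f i j - f i (j - 1) = dh i j" for i j
  proof (cases "i < - L")
    case True
    then have "\<bar>i\<bar> > L" by linarith
    then show ?thesis using True dh0[of i j] by (simp add: f_left)
  next
    case False
    then have "- L - 1 \<le> i" by simp
    then show ?thesis
    proof (induction i rule: int_ge_induct)
      case base
      have "L < \<bar>- L - 1\<bar>" by linarith
      then show ?case using dh0[of "- L - 1" j] by (simp add: f_left)
    next
      case (step i)
      then show ?case
        using fv[of "i + 1" j] fv[of "i + 1" "j - 1"] dd[of "i + 1" j]
        by simp
    qed
  qed
  have f_above: "f i j = 0" if "j > L \<or> j < - L" for i j
  proof -
    have "\<bar>j\<bar> > L" using that by linarith
    then show ?thesis by (simp add: f_def dv0)
  qed
  \<comment> \<open>The row sum does not show this directly. \<open>f\<close> vanishes above the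
    box, and one descends from there through a column without matched horizontal edges.\<close>
  have f_right: "f i j = 0" if "i > L" for i j
  proof (cases "j > L")
    case True
    then show ?thesis by (simp add: f_above)
  next
    case False
    then have "j \<le> L + 1" by simp
    then show ?thesis
    proof (induction j rule: int_le_induct)
      case base
      show ?case by (simp add: f_above)
    next
      case (step j)
      have "\<bar>i\<bar> > L" using that by linarith
      with step show ?case using fh[of i j] dh0[of i j] by simp
    qed
  qed
  show ?thesis
  proof (rule that[of f])
    show "\<And>i j. f i j \<noteq> 0 \<Longrightarrow> \<bar>i\<bar> \<le> L \<and> \<bar>j\<bar> \<le> L"
      using f_left f_right f_above by (metis abs_le_iff linorder_not_less minus_le_iff)
  qed (simp add: height_difference_def fv fh dv_def dh_def)
qed

lemma checker_Suc: "checker (c + 1) i j = - checker c i j"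
  by (auto simp: checker_def)

text \<open>The sign of the height difference is chosen so that it is positive somewhere. Its
  maximum then exceeds the value zero taken outside the box, so it is attained only inside. The
  offset \<open>c\<close> records the choice of sign.\<close>

lemma height_difference_max:
  fixes hA vA hB vB P :: "int \<Rightarrow> int \<Rightarrow> bool" and L :: int
  assumes mA: "grid_matching P hA vA"
    and mB: "grid_matching P hB vB"
    and bound: "\<And>i j. P i j \<Longrightarrow> \<bar>i\<bar> \<le> L \<and> \<bar>j\<bar> \<le> L"
    and diff: "hA i0 j0 \<noteq> hB i0 j0 \<or> vA i0 j0 \<noteq> vB i0 j0"
  obtains f :: "int \<Rightarrow> int \<Rightarrow> int" and c m :: int
  where "height_difference c hA vA hB vB f"
    and "\<And>i j. f i j \<le> m"
    and "\<exists>i j. f i j = m"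
    and "\<And>i j. f i j = m \<Longrightarrow> \<bar>i\<bar> \<le> L \<and> \<bar>j\<bar> \<le> L"
proof -
  obtain g :: "int \<Rightarrow> int \<Rightarrow> int"
    where g: "height_difference 0 hA vA hB vB g"
      and g0: "\<And>i j. g i j \<noteq> 0 \<Longrightarrow> \<bar>i\<bar> \<le> L \<and> \<bar>j\<bar> \<le> L"
    using height_difference_exists[OF mA mB bound] by blast
  note gv = height_differenceD(1)[OF g] and gh = height_differenceD(2)[OF g]
  have "\<exists>i j. g i j \<noteq> 0"
  proof (rule ccontr)
    assume "\<not> ?thesis"
    then show False
      using gv[of i0 j0] gh[of i0 j0] diff by (auto simp: checker_def split: if_splits)
  qed
  then obtain i1 j1 where "g i1 j1 \<noteq> 0" by blast
  \<comment> \<open>\<open>checker u 0 0\<close> is the sign of \<open>g i1 j1\<close>.\<close>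
  define u where "u = (if g i1 j1 > 0 then 0 else 1 :: int)"
  define f where "f i j = checker u 0 0 * g i j" for i j
  have pos: "f i1 j1 > 0" using \<open>g i1 j1 \<noteq> 0\<close> by (simp add: f_def u_def checker_def)
  have ch: "checker u i j = checker u 0 0 * checker 0 i j" for i j
    by (auto simp: u_def checker_def)
  have fv: "f i j - f (i - 1) j = checker u i j * (of_bool (vA i j) - of_bool (vB i j))" for i j
    unfolding ch[of i j] mult.assoc gv[symmetric] by (simp add: f_def right_diff_distrib)
  have fh: "f i j - f i (j - 1) = - checker u i j * (of_bool (hA i j) - of_bool (hB i j))" for i j
    using arg_cong[OF gh[of i j], of "(*) (checker u 0 0)"]
    by (simp add: f_def right_diff_distrib ch[of i j] mult.assoc)
  define S where "S = (\<lambda>(i, j). f i j) ` ({- L..L} \<times> {- L..L})"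
  have f0: "\<bar>i\<bar> \<le> L \<and> \<bar>j\<bar> \<le> L" if "f i j \<noteq> 0" for i j
    using that g0[of i j] by (auto simp: f_def)
  have inS: "f i j \<in> S" if "f i j \<noteq> 0" for i j
    using f0[OF that] unfolding S_def by (auto intro!: image_eqI[of _ _ "(i, j)"])
  have fin: "finite S" by (simp add: S_def)
  have S1: "f i1 j1 \<in> S" using pos by (intro inS) simp
  then have mpos: "Max S > 0" using Max_ge[OF fin S1] pos by linarith
  have "Max S \<in> S" using fin S1 by (intro Max_in) auto
  then have ex: "\<exists>i j. f i j = Max S" unfolding S_def by force
  show ?thesis
  proof (rule that[OF _ _ ex])
    show "height_difference u hA vA hB vB f" using fv fh by (simp add: height_difference_def)
    show "f i j \<le> Max S" for i j
      using Max_ge[OF fin inS[of i j]] mpos by (cases "f i j = 0") auto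
    show "\<bar>i\<bar> \<le> L \<and> \<bar>j\<bar> \<le> L" if "f i j = Max S" for i j
      using f0[of i j] that mpos by simp
  qed
qed

text \<open>The staircase begins at the leftmost maximal cell of the extreme diagonal and ends
  before the first gap. The last clause mentions the left and the top side because they share the
  upper left corner, which thus becomes a vertex where the matchings differ.\<close>

lemma resonant_cell_at_max:
  fixes hA vA hB vB P :: "int \<Rightarrow> int \<Rightarrow> bool" and f :: "int \<Rightarrow> int \<Rightarrow> int" and c m L :: int
  assumes mA: "grid_matching P hA vA"
    and mB: "grid_matching P hB vB"
    and ht: "height_difference c hA vA hB vB f"
    and ub: "\<And>i j. f i j \<le> m"
    and ex: "\<exists>i j. f i j = m"
    and bound: "\<And>i j. f i j = m \<Longrightarrow> \<bar>i\<bar> \<le> L \<and> \<bar>j\<bar> \<le> L"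
    and P: "\<And>i j. f i j = m \<Longrightarrow> P (i + 1) j"
  shows "\<exists>i j. f i j = m \<and>
      (hA i j \<and> hA i (j + 1) \<or> vA i j \<and> vA (i + 1) j \<or>
       hB i j \<and> hB i (j + 1) \<or> vB i j \<and> vB (i + 1) j) \<and>
      (vA i j \<noteq> vB i j \<or> hA i (j + 1) \<noteq> hB i (j + 1))"
proof -
  define R where "R = {(i, j). f i j = m}"
  have "R \<subseteq> {- L..L} \<times> {- L..L}" using bound by (auto simp: R_def abs_le_iff minus_le_iff)
  then have finR: "finite R" by (rule finite_subset) simp
  define D where "D = (\<lambda>(i, j). j - i) ` R"
  have finD: "finite D" and neD: "D \<noteq> {}" using finR ex by (auto simp: D_def R_def)
  define d where "d = Max D"
  have diag: "j - i \<le> d" if "f i j = m" for i j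
    unfolding d_def using finD that by (intro Max_ge) (force simp: D_def R_def)+
  define I where "I = {i. f i (i + d) = m}"
  have "d \<in> D" unfolding d_def using finD neD by (rule Max_in)
  then have neI: "I \<noteq> {}" by (force simp: D_def R_def I_def algebra_simps)
  have "I \<subseteq> fst ` R" by (force simp: R_def I_def)
  then have finI: "finite I" using finR finite_surj by blast
  define a where "a = Min I"
  define b where "b = a + d"
  have "a \<in> I" unfolding a_def using finI neI by (rule Min_in)
  then have fab: "f a b = m" by (simp add: I_def b_def)
  have start: "f (a - 1) (b - 1) \<noteq> m"
  proof
    assume "f (a - 1) (b - 1) = m"
    then have "a - 1 \<in> I" by (simp add: I_def b_def algebra_simps)
    then show False using Min_le[OF finI, of "a - 1"] by (simp add: a_def)
  qed
  have "\<exists>k. f (a + int k + 1) (b + int k + 1) \<noteq> m"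
  proof
    \<comment> \<open>This far along the diagonal the first coordinate has left the box.\<close>
    show "f (a + int (nat (L + \<bar>a\<bar>)) + 1) (b + int (nat (L + \<bar>a\<bar>)) + 1) \<noteq> m"
      using bound[of "a + int (nat (L + \<bar>a\<bar>)) + 1" "b + int (nat (L + \<bar>a\<bar>)) + 1"] by linarith
  qed
  then obtain p where stop: "f (a + int p + 1) (b + int p + 1) \<noteq> m"
    and least: "\<And>k. k < p \<Longrightarrow> f (a + int k + 1) (b + int k + 1) = m"
    using exists_least_iff[of "\<lambda>k. f (a + int k + 1) (b + int k + 1) \<noteq> m"] by blast
  have stairs: "f (a + int k) (b + int k) = m" if "k \<le> p" for k
    using least[of "k - 1"] that fab by (cases k) (auto simp: algebra_simps)
  have dg: "j - i \<le> b - a" if "f i j = m" for i j using diag[OF that] by (simp add: b_def)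
  show ?thesis
  proof (cases "even (a + b + c)")
    case True
    show ?thesis
      by (rule staircase[OF mA mB ht ub P dg True start stairs stop])
  next
    case False
    then have par: "even (a + b + (c + 1))" by simp
    \<comment> \<open>Raising the offset flips every sign and exchanging the matchings flips it
      back, so \<open>f\<close> is kept while the parity changes.\<close>
    have ht': "height_difference (c + 1) hB vB hA vA f"
      unfolding height_difference_def height_differenceD[OF ht] checker_Suc
      by (simp add: algebra_simps)
    show ?thesis
      using staircase[OF mB mA ht' ub P dg par start stairs stop] by blast
  qed
qed

section \<open>Finite faces of polyomino graphs\<close>

definition vedge :: "int \<Rightarrow> int \<Rightarrow> (int \<times> int) set" where
  "vedge i j = {(i, j), (i, j + 1)}"

definition hedge :: "int \<Rightarrow> int \<Rightarrow> (int \<times> int) set" where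
  "hedge i j = {(i, j), (i + 1, j)}"

definition cell :: "int \<Rightarrow> int \<Rightarrow> (real \<times> real) set" where
  "cell i j = box (pt (i, j)) (pt (i + 1, j + 1))"

lemma mem_edge_seg_vedge:
  "(x, y) \<in> edge_seg (vedge i j) \<longleftrightarrow> x = of_int i \<and> of_int j \<le> y \<and> y \<le> of_int j + 1"
  by (auto simp: edge_seg_def vedge_def pt_def segment_convex_hull[symmetric]
      closed_segment_same_fst closed_segment_eq_real_ivl)

lemma mem_edge_seg_hedge:
  "(x, y) \<in> edge_seg (hedge i j) \<longleftrightarrow> y = of_int j \<and> of_int i \<le> x \<and> x \<le> of_int i + 1"
  by (auto simp: edge_seg_def hedge_def pt_def segment_convex_hull[symmetric]
      closed_segment_same_snd closed_segment_eq_real_ivl)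

lemma mem_cell:
  "(x, y) \<in> cell i j \<longleftrightarrow> of_int i < x \<and> x < of_int i + 1 \<and> of_int j < y \<and> y < of_int j + 1"
  by (auto simp: cell_def pt_def box_prod)

lemma cell_nonempty: "cell i j \<noteq> {}"
proof -
  have "(of_int i + 1 / 2, of_int j + 1 / 2) \<in> cell i j" by (simp add: mem_cell)
  then show ?thesis by blast
qed

lemma connected_cell: "connected (cell i j)"
  by (simp add: cell_def convex_connected)

lemma frontier_cell: "frontier (cell i j) = frontier (cbox (pt (i, j)) (pt (i + 1, j + 1)))"
  using cell_nonempty[of i j] unfolding frontier_cbox cell_def frontier_box by simp

lemma mem_frontier_cell:
  "(x, y) \<in> frontier (cell i j) \<longleftrightarrow>
     (x = of_int i \<or> x = of_int i + 1) \<and> of_int j \<le> y \<and> y \<le> of_int j + 1 \<or>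
     (y = of_int j \<or> y = of_int j + 1) \<and> of_int i \<le> x \<and> x \<le> of_int i + 1"
  unfolding frontier_cell frontier_cbox
  by (auto simp: pt_def box_prod cbox_prod)

lemma no_int_between: "of_int i < (of_int k :: real) \<Longrightarrow> of_int k < (of_int i + 1 :: real) \<Longrightarrow> False"
  using of_int_less_iff[of i k, where 'a = real] of_int_less_iff[of k "i + 1", where 'a = real] by simp

text \<open>The interval is a neighbourhood of \<open>x\<close> that meets only the unit columns
  touching \<open>x\<close>: one column in general, two if \<open>x\<close> is an integer.\<close>

lemma floor_near:
  fixes x u :: real
  assumes "of_int (\<lceil>x\<rceil> - 1) < u" "u < of_int \<lfloor>x\<rfloor> + 1"
  shows "\<lfloor>u\<rfloor> = \<lfloor>x\<rfloor> \<or> x = of_int \<lfloor>x\<rfloor> \<and> \<lfloor>u\<rfloor> = \<lfloor>x\<rfloor> - 1"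
proof -
  have "\<lceil>x\<rceil> - 1 \<le> \<lfloor>u\<rfloor>" using assms(1) by (simp add: le_floor_iff)
  moreover have "\<lfloor>u\<rfloor> < \<lfloor>x\<rfloor> + 1" using assms(2) by linarith
  ultimately show ?thesis by (auto simp: ceiling_altdef split: if_splits)
qed

lemma int_between:
  assumes "of_int i < (x::real)" "x < of_int i + 1" "of_int i' \<le> x" "x \<le> of_int i' + 1"
  shows "i' = i"
  using assms by linarith

lemma pt_mem_frontier_cell:
  "pt (x, y) \<in> frontier (cell i j) \<longleftrightarrow> (x = i \<or> x = i + 1) \<and> (y = j \<or> y = j + 1)"
  unfolding pt_def fst_conv snd_conv mem_frontier_cell by (auto; linarith)

lemma grid_adj_cases:
  assumes "grid_adj u v"
  obtains i j where "{u, v} = vedge i j" | i j where "{u, v} = hedge i j"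
proof -
  obtain a b c d where [simp]: "u = (a, b)" "v = (c, d)" by (cases u, cases v)
  have "a = c \<and> (d = b + 1 \<or> b = d + 1) \<or> b = d \<and> (c = a + 1 \<or> a = c + 1)"
    using assms by (auto simp: grid_adj_def)
  then show ?thesis
    using that by (auto simp: vedge_def hedge_def insert_commute)
qed

lemma grid_edge_cases:
  assumes "grid_subgraph H" "e \<in> edges H"
  obtains i j where "e = vedge i j" | i j where "e = hedge i j"
  using assms unfolding grid_subgraph_def by (metis grid_adj_cases)

lemma edge_subset_verts: "grid_subgraph H \<Longrightarrow> e \<in> edges H \<Longrightarrow> e \<subseteq> verts H"
  unfolding grid_subgraph_def by auto

lemma drawing_cases:
  assumes "grid_subgraph H" "(x, y) \<in> drawing H"
  obtains i j where "x = of_int i" "y = of_int j" "(i, j) \<in> verts H"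
  | i j where "vedge i j \<in> edges H" "(x, y) \<in> edge_seg (vedge i j)"
  | i j where "hedge i j \<in> edges H" "(x, y) \<in> edge_seg (hedge i j)"
  using assms(2) unfolding drawing_def
proof
  assume "(x, y) \<in> pt ` verts H"
  then show ?thesis using that(1) by (auto simp: pt_def)
next
  assume "(x, y) \<in> (\<Union>e\<in>edges H. edge_seg e)"
  then obtain e where "e \<in> edges H" "(x, y) \<in> edge_seg e" by blast
  then show ?thesis using grid_edge_cases[OF assms(1)] that by metis
qed

text \<open>The relative interior of a unit grid segment contains no lattice point and meets no
  other grid segment, so a single drawn point in it forces the edge.\<close>

lemma drawing_vedge:
  assumes "grid_subgraph H" "(of_int i, y) \<in> drawing H" "of_int j < y" "y < of_int j + 1"
  shows "vedge i j \<in> edges H"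
  using assms(1,2)
proof (cases rule: drawing_cases)
  case (1 i' j')
  then show ?thesis using assms(3,4) no_int_between by blast
next
  case (2 i' j')
  then have "i' = i" "j' = j" using assms(3,4) int_between[of j y j'] by (auto simp: mem_edge_seg_vedge)
  then show ?thesis using 2 by simp
next
  case (3 i' j')
  then show ?thesis using assms(3,4) no_int_between unfolding mem_edge_seg_hedge by blast
qed

lemma drawing_hedge:
  assumes "grid_subgraph H" "(x, of_int j) \<in> drawing H" "of_int i < x" "x < of_int i + 1"
  shows "hedge i j \<in> edges H"
  using assms(1,2)
proof (cases rule: drawing_cases)
  case (1 i' j')
  then show ?thesis using assms(3,4) no_int_between by blast
next
  case (2 i' j')
  then show ?thesis using assms(3,4) no_int_between unfolding mem_edge_seg_vedge by blast
next
  case (3 i' j')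
  then have "i' = i" "j' = j" using assms(3,4) int_between[of i x i'] by (auto simp: mem_edge_seg_hedge)
  then show ?thesis using 3 by simp
qed

section \<open>Faces as unit cells\<close>

lemma cell_disjoint_drawing:
  assumes "grid_subgraph H"
  shows "cell i j \<subseteq> - drawing H"
proof
  fix z assume "z \<in> cell i j"
  then obtain x y where [simp]: "z = (x, y)" and z: "(x, y) \<in> cell i j" by (cases z) auto
  have "(x, y) \<notin> drawing H"
  proof
    assume "(x, y) \<in> drawing H"
    with assms show False
      by (cases rule: drawing_cases)
        (use z no_int_between in \<open>unfold mem_cell mem_edge_seg_vedge mem_edge_seg_hedge, blast+\<close>)
  qed
  then show "z \<in> - drawing H" by simp
qed

lemma closed_drawing:
  assumes "grid_subgraph H" "finite (verts H)"
  shows "closed (drawing H)"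
proof -
  have "edges H \<subseteq> Pow (verts H)" using edge_subset_verts[OF assms(1)] by blast
  then have "finite (edges H)" using assms(2) by (meson finite_Pow_iff finite_subset)
  moreover have "closed (edge_seg e)" if "e \<in> edges H" for e
    using finite_subset[OF edge_subset_verts[OF assms(1) that] assms(2)]
    by (simp add: edge_seg_def compact_imp_closed compact_convex_hull finite_imp_compact)
  ultimately show ?thesis
    unfolding drawing_def using assms(2) by (intro closed_Un closed_UN finite_imp_closed) auto
qed

definition cell_edges :: "int \<Rightarrow> int \<Rightarrow> (int \<times> int) set set" where
  "cell_edges i j = {hedge i j, vedge (i + 1) j, hedge i (j + 1), vedge i j}"

lemma edge_seg_subset_frontier_cell:
  "e \<in> cell_edges i j \<Longrightarrow> edge_seg e \<subseteq> frontier (cell i j)"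
  by (auto simp: cell_edges_def mem_edge_seg_vedge mem_edge_seg_hedge mem_frontier_cell)

text \<open>The midpoint of an edge has one half-integral coordinate, so it lies on the frontier of
  the cell only if the edge is one of the four sides.\<close>

lemma cell_edgeI:
  assumes "grid_subgraph H" "e \<in> edges H" "edge_seg e \<subseteq> frontier (cell i j)"
  shows "e \<in> cell_edges i j"
  using assms(1,2)
proof (cases rule: grid_edge_cases)
  case (1 a b)
  then have "(of_int a, of_int b + 1 / 2) \<in> frontier (cell i j)"
    using assms(3) by (auto simp: mem_edge_seg_vedge)
  then have "(a = i \<or> a = i + 1) \<and> b = j"
    unfolding mem_frontier_cell by linarith
  then show ?thesis using 1 by (auto simp: cell_edges_def)
next
  case (2 a b)
  then have "(of_int a + 1 / 2, of_int b) \<in> frontier (cell i j)"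
    using assms(3) by (auto simp: mem_edge_seg_hedge)
  then have "(b = j \<or> b = j + 1) \<and> a = i"
    unfolding mem_frontier_cell by linarith
  then show ?thesis using 2 by (auto simp: cell_edges_def)
qed

text \<open>A face is connected and misses its frontier, here the boundary of a square, so it lies
  inside or outside that square. Boundedness excludes the outside, and connectedness of the cell
  makes the face fill it. The frontier of a face is drawn, which yields the four edges.\<close>

lemma finite_face_cell:
  assumes H: "polyomino_graph H" and F: "F \<in> finite_faces H"
  obtains i j where "F = cell i j" "cell_edges i j \<subseteq> edges H" "boundary_edges H F = cell_edges i j"
proof -
  have sub: "grid_subgraph H" and fin: "finite (verts H)" using H by (auto simp: polyomino_graph_def)
  note cl = closed_drawing[OF sub fin]
  obtain i j where "frontier F = frontier (cbox (pt (i, j)) (pt (i + 1, j + 1)))"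
    using H F by (auto simp: polyomino_graph_def bounded_by_unit_square_def)
  then have fr: "frontier F = frontier (cell i j)" by (simp add: frontier_cell)
  let ?B = "cbox (pt (i, j)) (pt (i + 1, j + 1))"
  have comp: "F \<in> components (- drawing H)" and bdd: "bounded F" using F by (auto simp: finite_faces_def)
  have conn: "connected F" and ne: "F \<noteq> {}"
    using comp in_components_connected in_components_nonempty by blast+
  have "open F" using comp cl open_components by blast
  then have disj: "F \<inter> frontier F = {}" using frontier_disjoint_eq by blast
  \<comment> \<open>Otherwise the exterior of the square, which is connected and misses the frontier
    of \<open>F\<close>, would be contained in the bounded set \<open>F\<close>.\<close>
  have "F \<inter> ?B \<noteq> {}"
  proof
    assume em: "F \<inter> ?B = {}"
    have "connected (- ?B)" by (rule connected_complement_bounded_convex) auto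
    moreover have "- ?B \<inter> frontier F = {}" by (auto simp: fr frontier_cell frontier_cbox)
    moreover have "- ?B \<inter> F \<noteq> {}" using ne em by blast
    ultimately have "- ?B \<subseteq> F" using connected_Int_frontier[of "- ?B" F] by blast
    then have "bounded (- ?B)" using bdd bounded_subset by blast
    then show False using cobounded_imp_unbounded[of "- ?B"] by simp
  qed
  moreover have "F \<inter> frontier ?B = {}" using disj fr by (simp add: frontier_cell)
  ultimately have "F \<subseteq> ?B" using connected_Int_frontier[OF conn, of ?B] by blast
  then have sub1: "F \<subseteq> cell i j"
    using \<open>F \<inter> frontier ?B = {}\<close> by (auto simp: frontier_cbox cell_def)
  have "cell i j \<inter> frontier F = {}"
    unfolding fr by (auto simp: cell_def frontier_box)
  then have "cell i j \<subseteq> F"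
    using connected_Int_frontier[OF connected_cell, of i j F] sub1 ne by blast
  with sub1 have eq: "F = cell i j" by blast
  have sd: "frontier (cell i j) \<subseteq> drawing H"
    using frontier_of_components_closed_complement[OF cl comp] by (simp add: eq)
  have v: "vedge a j \<in> edges H" if "a = i \<or> a = i + 1" for a
  proof (rule drawing_vedge[OF sub])
    show "(of_int a, of_int j + 1 / 2) \<in> drawing H"
      using that by (intro subsetD[OF sd]) (auto simp: mem_frontier_cell)
  qed auto
  have h: "hedge i b \<in> edges H" if "b = j \<or> b = j + 1" for b
  proof (rule drawing_hedge[OF sub])
    show "(of_int i + 1 / 2, of_int b) \<in> drawing H"
      using that by (intro subsetD[OF sd]) (auto simp: mem_frontier_cell)
  qed auto
  have ce: "cell_edges i j \<subseteq> edges H" using v h by (auto simp: cell_edges_def)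
  have "boundary_edges H F = cell_edges i j"
    unfolding boundary_edges_def eq
    using ce edge_seg_subset_frontier_cell cell_edgeI[OF sub] by blast
  with eq ce that show ?thesis by blast
qed

text \<open>A function on cells that only changes across edges of \<open>H\<close> is locally constant off the
  drawing, so a face meeting one of finitely many cells of a level set is bounded.\<close>

lemma level_cell_is_face:
  fixes f :: "int \<Rightarrow> int \<Rightarrow> int"
  assumes H: "polyomino_graph H"
    and fv: "\<And>i j. vedge i j \<notin> edges H \<Longrightarrow> f (i - 1) j = f i j"
    and fh: "\<And>i j. hedge i j \<notin> edges H \<Longrightarrow> f i (j - 1) = f i j"
    and bound: "\<And>i j. f i j = m \<Longrightarrow> \<bar>i\<bar> \<le> L \<and> \<bar>j\<bar> \<le> L"
    and fm: "f i j = m"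
  shows "cell i j \<in> finite_faces H" and "cell_edges i j \<subseteq> edges H"
    and "boundary_edges H (cell i j) = cell_edges i j"
proof -
  have sub: "grid_subgraph H" using H by (simp add: polyomino_graph_def)
  \<comment> \<open>The floor functions assign points on the left and bottom sides to the cell
    itself; this choice is harmless off the drawing.\<close>
  define g where "g = (\<lambda>z :: real \<times> real. f \<lfloor>fst z\<rfloor> \<lfloor>snd z\<rfloor>)"
  have near: "\<exists>T. open T \<and> z \<in> T \<and> (\<forall>w\<in>T. g w = g z)" if z: "z \<notin> drawing H" for z
  proof -
    obtain x y where [simp]: "z = (x, y)" by (cases z)
    define X where "X = {of_int (\<lceil>x\<rceil> - 1)<..<of_int \<lfloor>x\<rfloor> + 1 :: real}"
    define Y where "Y = {of_int (\<lceil>y\<rceil> - 1)<..<of_int \<lfloor>y\<rfloor> + 1 :: real}"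
    have "x \<in> X" "y \<in> Y" unfolding X_def Y_def greaterThanLessThan_iff by linarith+
    have "g (u, w) = g (x, y)" if u: "u \<in> X" and w: "w \<in> Y" for u w
    proof -
      have fu: "\<lfloor>u\<rfloor> = \<lfloor>x\<rfloor> \<or> x = of_int \<lfloor>x\<rfloor> \<and> \<lfloor>u\<rfloor> = \<lfloor>x\<rfloor> - 1"
        using u floor_near by (simp add: X_def)
      have fw: "\<lfloor>w\<rfloor> = \<lfloor>y\<rfloor> \<or> y = of_int \<lfloor>y\<rfloor> \<and> \<lfloor>w\<rfloor> = \<lfloor>y\<rfloor> - 1"
        using w floor_near by (simp add: Y_def)
      \<comment> \<open>An integral \<open>x\<close> puts \<open>z\<close> on the closed left side
        of cell \<open>(\<lfloor>x\<rfloor>, b)\<close>; since \<open>z\<close> is not drawn, that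
        side is no edge. The second choice of \<open>b\<close> occurs when \<open>y\<close> is
        integral too.\<close>
      have V: "f (\<lfloor>x\<rfloor> - 1) b = f \<lfloor>x\<rfloor> b"
        if "x = of_int \<lfloor>x\<rfloor>" "b = \<lfloor>y\<rfloor> \<or> y = of_int \<lfloor>y\<rfloor> \<and> b = \<lfloor>y\<rfloor> - 1" for b
      proof (rule fv, rule notI)
        assume "vedge \<lfloor>x\<rfloor> b \<in> edges H"
        moreover have "(x, y) \<in> edge_seg (vedge \<lfloor>x\<rfloor> b)"
          using that unfolding mem_edge_seg_vedge by linarith
        ultimately show False using z by (auto simp: drawing_def)
      qed
      have Hh: "f a (\<lfloor>y\<rfloor> - 1) = f a \<lfloor>y\<rfloor>"
        if "y = of_int \<lfloor>y\<rfloor>" "a = \<lfloor>x\<rfloor> \<or> x = of_int \<lfloor>x\<rfloor> \<and> a = \<lfloor>x\<rfloor> - 1" for a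
      proof (rule fh, rule notI)
        assume "hedge a \<lfloor>y\<rfloor> \<in> edges H"
        moreover have "(x, y) \<in> edge_seg (hedge a \<lfloor>y\<rfloor>)"
          using that unfolding mem_edge_seg_hedge by linarith
        ultimately show False using z by (auto simp: drawing_def)
      qed
      have "f \<lfloor>u\<rfloor> \<lfloor>w\<rfloor> = f \<lfloor>x\<rfloor> \<lfloor>w\<rfloor>" using fu V[OF _ fw] by auto
      also have "\<dots> = f \<lfloor>x\<rfloor> \<lfloor>y\<rfloor>" using fw Hh[of "\<lfloor>x\<rfloor>"] by auto
      finally show ?thesis by (simp add: g_def)
    qed
    then have "\<forall>w\<in>X \<times> Y. g w = g z" by auto
    moreover have "open (X \<times> Y)" by (intro open_Times) (simp_all add: X_def Y_def)
    moreover have "z \<in> X \<times> Y" using \<open>x \<in> X\<close> \<open>y \<in> Y\<close> by simp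
    ultimately show ?thesis by blast
  qed
  define c where "c = (of_int i + 1 / 2 :: real, of_int j + 1 / 2 :: real)"
  have c: "c \<in> cell i j" by (simp add: c_def mem_cell)
  define F where "F = connected_component_set (- drawing H) c"
  have cd: "c \<in> - drawing H" using c cell_disjoint_drawing[OF sub] by blast
  have comp: "F \<in> components (- drawing H)" unfolding F_def using cd by (rule componentsI)
  have cF: "c \<in> F" using cd by (simp add: F_def)
  have "g constant_on F"
  proof (rule locally_constant_imp_constant)
    show "connected F" by (simp add: F_def)
    fix z assume "z \<in> F"
    then have "z \<notin> drawing H" using in_components_subset[OF comp] by auto
    then obtain T where T: "open T" "z \<in> T" "\<forall>w\<in>T. g w = g z" using near by blast
    show "\<exists>T. openin (top_of_set F) T \<and> z \<in> T \<and> (\<forall>w\<in>T. g w = g z)"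
      using T(2,3) \<open>z \<in> F\<close> openin_open_Int[OF T(1), of F] by blast
  qed
  then have const: "g z = g c" if "z \<in> F" for z using cF that by (metis constant_on_def)
  have "\<lfloor>of_int i + 1 / 2 :: real\<rfloor> = i" "\<lfloor>of_int j + 1 / 2 :: real\<rfloor> = j" by linarith+
  then have "g c = m" by (simp add: g_def c_def fm)
  have "F \<subseteq> {- of_int L - 1..of_int L + 1} \<times> {- of_int L - 1..of_int L + 1}"
  proof
    fix z assume "z \<in> F"
    then have "f \<lfloor>fst z\<rfloor> \<lfloor>snd z\<rfloor> = m" using const \<open>g c = m\<close> by (simp add: g_def)
    from bound[OF this] have "\<bar>\<lfloor>fst z\<rfloor>\<bar> \<le> L" "\<bar>\<lfloor>snd z\<rfloor>\<bar> \<le> L" by auto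
    then have "fst z \<in> {- of_int L - 1..of_int L + 1}" "snd z \<in> {- of_int L - 1..of_int L + 1}"
      unfolding atLeastAtMost_iff by linarith+
    then show "z \<in> {- of_int L - 1..of_int L + 1} \<times> {- of_int L - 1..of_int L + 1}"
      by (simp add: mem_Times_iff)
  qed
  then have "bounded F"
    by (rule bounded_subset[OF bounded_Times[OF bounded_closed_interval bounded_closed_interval]])
  then have face: "F \<in> finite_faces H" using comp by (simp add: finite_faces_def)
  obtain a b where ab: "F = cell a b" "cell_edges a b \<subseteq> edges H" "boundary_edges H F = cell_edges a b"
    using finite_face_cell[OF H face] .
  have "c \<in> cell a b" using cF ab by simp
  then have "a = i" "b = j" unfolding c_def mem_cell by linarith+
  then show "cell i j \<in> finite_faces H" "cell_edges i j \<subseteq> edges H"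
    "boundary_edges H (cell i j) = cell_edges i j" using ab face by auto
qed

section \<open>Resonant faces and maximal alternating sets\<close>

lemma perfect_matching_unique:
  "perfect_matching G M \<Longrightarrow> v \<in> verts G \<Longrightarrow> e \<in> M \<Longrightarrow> e' \<in> M \<Longrightarrow> v \<in> e \<Longrightarrow> v \<in> e' \<Longrightarrow> e = e'"
  unfolding perfect_matching_def by blast

text \<open>The four edges in the sum are distinct and are the only grid edges at the vertex, so the
  sum counts the matching edges there.\<close>

lemma perfect_matching_grid_matching:
  assumes sub: "grid_subgraph H" and M: "perfect_matching H M"
  shows "grid_matching (\<lambda>i j. (i, j) \<in> verts H) (\<lambda>i j. hedge i j \<in> M) (\<lambda>i j. vedge i j \<in> M)"
  unfolding grid_matching_def
proof (intro allI)
  fix i j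
  let ?S = "{hedge i j, hedge (i - 1) j, vedge i j, vedge i (j - 1)}"
  have ME: "M \<subseteq> edges H" using M by (simp add: perfect_matching_def)
  have star: "(i, j) \<in> e \<longleftrightarrow> e \<in> ?S" if "e \<in> M" for e
    using grid_edge_cases[OF sub subsetD[OF ME that]]
    by cases (auto simp: vedge_def hedge_def doubleton_eq_iff)
  have inS: "(i, j) \<in> e" if "e \<in> ?S" for e using that by (auto simp: vedge_def hedge_def)
  have dist: "hedge i j \<noteq> hedge (i - 1) j" "hedge i j \<noteq> vedge i j" "hedge i j \<noteq> vedge i (j - 1)"
    "hedge (i - 1) j \<noteq> vedge i j" "hedge (i - 1) j \<noteq> vedge i (j - 1)" "vedge i j \<noteq> vedge i (j - 1)"
    by (auto simp: vedge_def hedge_def doubleton_eq_iff)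
  show "of_bool (hedge i j \<in> M) + of_bool (hedge (i - 1) j \<in> M) + of_bool (vedge i j \<in> M)
     + of_bool (vedge i (j - 1) \<in> M) = (of_bool ((i, j) \<in> verts H) :: int)"
  proof (cases "(i, j) \<in> verts H")
    case True
    then obtain e where e: "e \<in> M" "(i, j) \<in> e" using M unfolding perfect_matching_def by blast
    have only: "e' \<in> M \<longleftrightarrow> e' = e" if "e' \<in> ?S" for e'
      using perfect_matching_unique[OF M True _ e(1) inS[OF that] e(2)] e(1) by blast
    have "e \<in> ?S" using e star by blast
    with only[of "hedge i j"] only[of "hedge (i - 1) j"] only[of "vedge i j"]
      only[of "vedge i (j - 1)"] dist True
    show ?thesis by (elim insertE) (auto simp: of_bool_def)
  next
    case False
    have "e \<notin> M" if "e \<in> ?S" for e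
      using edge_subset_verts[OF sub] ME inS[OF that] False by blast
    then have "hedge i j \<notin> M" "hedge (i - 1) j \<notin> M" "vedge i j \<notin> M" "vedge i (j - 1) \<notin> M" by blast+
    then show ?thesis using False by simp
  qed
qed

text \<open>Each of the other two sides shares an end point with a matched one and is therefore
  unmatched, so the boundary alternates.\<close>

lemma resonant_cellI:
  assumes H: "grid_subgraph H" and M: "perfect_matching H M"
    and ce: "cell_edges i j \<subseteq> edges H" and bd: "boundary_edges H (cell i j) = cell_edges i j"
    and par: "hedge i j \<in> M \<and> hedge i (j + 1) \<in> M \<or> vedge i j \<in> M \<and> vedge (i + 1) j \<in> M"
  shows "resonant H M (cell i j)"
proof -
  let ?xs = "[(i, j), (i + 1, j), (i + 1, j + 1), (i, j + 1)]"
  have e0: "cycle_edge ?xs 0 = hedge i j" and e1: "cycle_edge ?xs (Suc 0) = vedge (i + 1) j"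
    and e2: "cycle_edge ?xs (Suc (Suc 0)) = hedge i (j + 1)"
    and e3: "cycle_edge ?xs (Suc (Suc (Suc 0))) = vedge i j"
    and e4: "cycle_edge ?xs (Suc (Suc (Suc (Suc 0)))) = hedge i j"
    by (auto simp: cycle_edge_def vedge_def hedge_def)
  have four: "{..<length ?xs} = {0, Suc 0, Suc (Suc 0), Suc (Suc (Suc 0))}" by auto
  have cyc: "cycle_edges ?xs = cell_edges i j"
    unfolding cycle_edges_def four by (simp add: e0 e1 e2 e3 cell_edges_def)
  have "hedge i j \<subseteq> verts H" "hedge i (j + 1) \<subseteq> verts H"
    using ce edge_subset_verts[OF H] by (auto simp: cell_edges_def)
  then have "is_cycle H ?xs"
    using ce cyc by (simp add: is_cycle_def hedge_def)
  note u = grid_matchingD(1-3)[OF perfect_matching_grid_matching[OF H M]]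
  have "hedge i j \<in> M \<longleftrightarrow> vedge (i + 1) j \<notin> M" "vedge (i + 1) j \<in> M \<longleftrightarrow> hedge i (j + 1) \<notin> M"
    "hedge i (j + 1) \<in> M \<longleftrightarrow> vedge i j \<notin> M" "vedge i j \<in> M \<longleftrightarrow> hedge i j \<notin> M"
    using par u(1)[of i j] u(2)[of "i + 1" j] u(1)[of i "j + 1"] u(2)[of "i + 1" "j + 1"] by auto
  then have "\<forall>k\<in>{..<length ?xs}. cycle_edge ?xs k \<in> M \<longleftrightarrow> cycle_edge ?xs (Suc k) \<notin> M"
    unfolding four by (simp add: e0 e1 e2 e3 e4)
  then have "alternating_cycle H M ?xs"
    using \<open>is_cycle H ?xs\<close> by (simp add: alternating_cycle_def)
  then show ?thesis unfolding resonant_def bd using cyc by blast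
qed

lemma alternating_cycle_matched:
  assumes "alternating_cycle H M xs" "v \<in> set xs"
  obtains e where "e \<in> M" "v \<in> e" "e \<in> cycle_edges xs"
proof -
  obtain k where k: "k < length xs" "v = xs ! k" using assms(2) by (auto simp: in_set_conv_nth)
  \<comment> \<open>The cyclic predecessor of \<open>k\<close>: the edges number \<open>k'\<close>
    and \<open>k\<close> both contain \<open>v\<close>, and alternation puts one of them into
    \<open>M\<close>.\<close>
  define k' where "k' = (if k = 0 then length xs - 1 else k - 1)"
  have k': "k' < length xs" "Suc k' mod length xs = k" using k by (auto simp: k'_def)
  have eq: "cycle_edge xs (Suc k') = cycle_edge xs k"
    using k k' by (simp add: cycle_edge_def mod_Suc_eq mod_simps)
      (metis k'(2) mod_Suc_eq mod_mod_trivial)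
  have "v \<in> cycle_edge xs k'" "v \<in> cycle_edge xs k" using k k' by (auto simp: cycle_edge_def)
  moreover have "cycle_edge xs k' \<in> cycle_edges xs" "cycle_edge xs k \<in> cycle_edges xs"
    using k k' by (auto simp: cycle_edges_def)
  moreover have "cycle_edge xs k' \<in> M \<or> cycle_edge xs k \<in> M"
    using assms(1) k' eq by (auto simp: alternating_cycle_def)
  ultimately show ?thesis using that by blast
qed

text \<open>The boundary cycle already matches each corner of the face, so the matching edge at a
  corner cannot leave the face. This makes the vertices on the faces of \<open>K\<close> closed
  under the matching.\<close>

lemma resonant_face_matched:
  assumes H: "polyomino_graph H" and M: "perfect_matching H M"
    and F: "F \<in> finite_faces H" and res: "resonant H M F"
    and v: "v \<in> verts H" "pt v \<in> frontier F" and e: "e \<in> M" "v \<in> e" and u: "u \<in> e"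
  shows "pt u \<in> frontier F"
proof -
  obtain i j where F': "F = cell i j" "boundary_edges H F = cell_edges i j"
    using finite_face_cell[OF H F] by metis
  obtain xs where xs: "cycle_edges xs = boundary_edges H F" "alternating_cycle H M xs"
    using res by (auto simp: resonant_def)
  obtain x y where [simp]: "v = (x, y)" by (cases v)
  have "(x = i \<or> x = i + 1) \<and> (y = j \<or> y = j + 1)"
    using v(2) by (simp add: F' pt_mem_frontier_cell)
  then have "\<exists>e'\<in>cell_edges i j. v \<in> e'" by (auto simp: cell_edges_def vedge_def hedge_def)
  then have "\<exists>e'\<in>cycle_edge xs ` {..<length xs}. v \<in> e'"
    using xs F' by (simp add: cycle_edges_def)
  then obtain k where "k < length xs" "v \<in> cycle_edge xs k" by blast
  moreover have "cycle_edge xs k \<subseteq> set xs"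
    using \<open>k < length xs\<close> by (auto simp: cycle_edge_def intro!: nth_mem mod_less_divisor)
  ultimately obtain e' where e': "e' \<in> M" "v \<in> e'" "e' \<in> cycle_edges xs"
    using alternating_cycle_matched[OF xs(2)] by blast
  then have "e' = e" using perfect_matching_unique[OF M v(1)] e by blast
  then have "edge_seg e \<subseteq> frontier F" using e' xs by (auto simp: boundary_edges_def)
  moreover have "pt u \<in> edge_seg e" using u by (auto simp: edge_seg_def intro: hull_inc)
  ultimately show ?thesis by blast
qed

text \<open>The maximal cells of the height difference are faces, because it changes only across
  edges, and one of them is resonant for \<open>A\<close> or \<open>B\<close>. The vertex
  \<open>v\<close>, where the matchings differ, later shows that this face is new.\<close>

lemma two_matchings_resonant_face:
  assumes H: "polyomino_graph H" and A: "perfect_matching H A" and B: "perfect_matching H B"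
    and neq: "A \<noteq> B"
  obtains F v e where "F \<in> finite_faces H" "resonant H A F \<or> resonant H B F"
    "v \<in> verts H" "pt v \<in> frontier F" "v \<in> e" "(e \<in> A) \<noteq> (e \<in> B)"
proof -
  have sub: "grid_subgraph H" and fin: "finite (verts H)" using H by (auto simp: polyomino_graph_def)
  define P where "P i j \<longleftrightarrow> (i, j) \<in> verts H" for i j
  define h where "h M i j \<longleftrightarrow> hedge i j \<in> M" for M i j
  define v where "v M i j \<longleftrightarrow> vedge i j \<in> M" for M i j
  have mA: "grid_matching P (h A) (v A)" and mB: "grid_matching P (h B) (v B)"
    using perfect_matching_grid_matching[OF sub A] perfect_matching_grid_matching[OF sub B]
    by (simp_all add: grid_matching_def P_def h_def v_def)
  define L where "L = Max (insert 0 ((\<lambda>(i, j). max \<bar>i\<bar> \<bar>j\<bar>) ` verts H))"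
  have bound: "\<bar>i\<bar> \<le> L \<and> \<bar>j\<bar> \<le> L" if "P i j" for i j
  proof -
    have "max \<bar>i\<bar> \<bar>j\<bar> \<le> L" unfolding L_def using fin that by (intro Max_ge) (force simp: P_def)+
    then show ?thesis by simp
  qed
  have AE: "A \<subseteq> edges H" and BE: "B \<subseteq> edges H" using A B by (auto simp: perfect_matching_def)
  obtain e0 where e0: "(e0 \<in> A) \<noteq> (e0 \<in> B)" using neq by blast
  then have "e0 \<in> edges H" using AE BE by blast
  then obtain i0 j0 where "e0 = vedge i0 j0 \<or> e0 = hedge i0 j0" by (meson grid_edge_cases[OF sub])
  with e0 have diff: "h A i0 j0 \<noteq> h B i0 j0 \<or> v A i0 j0 \<noteq> v B i0 j0" by (auto simp: h_def v_def)
  obtain f c m where ht: "height_difference c (h A) (v A) (h B) (v B) f"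
    and ub: "\<And>i j. f i j \<le> m" and ex: "\<exists>i j. f i j = m"
    and fb: "\<And>i j. f i j = m \<Longrightarrow> \<bar>i\<bar> \<le> L \<and> \<bar>j\<bar> \<le> L"
    by (rule height_difference_max[OF mA mB bound diff]) (assumption, rule that)
  have fv: "f (i - 1) j = f i j" if "vedge i j \<notin> edges H" for i j
  proof -
    have "\<not> v A i j" "\<not> v B i j" using that AE BE by (auto simp: v_def)
    then show ?thesis using height_differenceD(1)[OF ht, of i j] by simp
  qed
  have fh: "f i (j - 1) = f i j" if "hedge i j \<notin> edges H" for i j
  proof -
    have "\<not> h A i j" "\<not> h B i j" using that AE BE by (auto simp: h_def)
    then show ?thesis using height_differenceD(2)[OF ht, of i j] by simp
  qed
  have face: "cell i j \<in> finite_faces H" "cell_edges i j \<subseteq> edges H"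
    "boundary_edges H (cell i j) = cell_edges i j" if "f i j = m" for i j
    by (rule level_cell_is_face[where f = f and m = m and L = L, OF H fv fh fb that]; assumption)+
  have P: "P (i + 1) j" if "f i j = m" for i j
    using face(2)[OF that] edge_subset_verts[OF sub, of "hedge i j"]
    by (auto simp: P_def cell_edges_def hedge_def)
  have "\<exists>i j. f i j = m \<and> (h A i j \<and> h A i (j + 1) \<or> v A i j \<and> v A (i + 1) j \<or>
      h B i j \<and> h B i (j + 1) \<or> v B i j \<and> v B (i + 1) j) \<and>
      (v A i j \<noteq> v B i j \<or> h A i (j + 1) \<noteq> h B i (j + 1))"
    by (rule resonant_cell_at_max[OF mA mB ht ub ex fb P])
  then obtain i j where ij: "f i j = m"
    and opp: "hedge i j \<in> A \<and> hedge i (j + 1) \<in> A \<or> vedge i j \<in> A \<and> vedge (i + 1) j \<in> A \<or>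
      hedge i j \<in> B \<and> hedge i (j + 1) \<in> B \<or> vedge i j \<in> B \<and> vedge (i + 1) j \<in> B"
    and dif: "(vedge i j \<in> A) \<noteq> (vedge i j \<in> B) \<or> (hedge i (j + 1) \<in> A) \<noteq> (hedge i (j + 1) \<in> B)"
    unfolding h_def v_def by blast
  have res: "resonant H A (cell i j) \<or> resonant H B (cell i j)"
    using opp resonant_cellI[OF sub A face(2)[OF ij] face(3)[OF ij]] resonant_cellI[OF sub B face(2)[OF ij] face(3)[OF ij]]
    by blast
  \<comment> \<open>The upper left corner lies on both the left and the top side, so it serves in
    either case of \<open>dif\<close>.\<close>
  have w: "(i, j + 1) \<in> verts H"
    using face(2)[OF ij] edge_subset_verts[OF sub, of "vedge i j"]
    by (auto simp: cell_edges_def vedge_def)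
  have fr: "pt (i, j + 1) \<in> frontier (cell i j)" by (simp add: pt_mem_frontier_cell)
  from dif show ?thesis
  proof
    assume "(vedge i j \<in> A) \<noteq> (vedge i j \<in> B)"
    then show ?thesis using that[OF face(1)[OF ij] res w fr, of "vedge i j"] by (simp add: v_def vedge_def)
  next
    assume "(hedge i (j + 1) \<in> A) \<noteq> (hedge i (j + 1) \<in> B)"
    then show ?thesis using that[OF face(1)[OF ij] res w fr, of "hedge i (j + 1)"] by (simp add: h_def hedge_def)
  qed
qed

section \<open>Deleting a vertex set that no matching edge leaves\<close>

lemma perfect_matching_delete_verts:
  assumes M: "perfect_matching G M" and closed: "\<And>e. e \<in> M \<Longrightarrow> e \<inter> S \<noteq> {} \<Longrightarrow> e \<subseteq> S"
  shows "perfect_matching (delete_verts G S) {e \<in> M. e \<inter> S = {}}"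
  unfolding perfect_matching_def delete_verts_def graph.simps
proof (intro conjI ballI)
  show "{e \<in> M. e \<inter> S = {}} \<subseteq> {e \<in> edges G. e \<inter> S = {}}"
    using M by (auto simp: perfect_matching_def)
  fix v assume v: "v \<in> verts G - S"
  then have "\<exists>!e. e \<in> M \<and> v \<in> e" using M by (auto simp: perfect_matching_def)
  moreover have "e \<inter> S = {}" if "e \<in> M" "v \<in> e" for e using closed[OF that(1)] that(2) v by blast
  ultimately show "\<exists>!e. e \<in> {e \<in> M. e \<inter> S = {}} \<and> v \<in> e" by auto
qed

text \<open>Edges of \<open>N\<close> avoid \<open>S\<close>, and edges of \<open>M\<close> meeting
  \<open>S\<close> stay inside it, so each vertex is covered by exactly one of the two
  families.\<close>

lemma perfect_matching_extend:
  assumes M: "perfect_matching G M" and closed: "\<And>e. e \<in> M \<Longrightarrow> e \<inter> S \<noteq> {} \<Longrightarrow> e \<subseteq> S"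
    and N: "perfect_matching (delete_verts G S) N"
  shows "perfect_matching G (N \<union> {e \<in> M. e \<inter> S \<noteq> {}})"
  unfolding perfect_matching_def
proof (intro conjI ballI)
  have NE: "N \<subseteq> {e \<in> edges G. e \<inter> S = {}}" using N by (simp add: perfect_matching_def delete_verts_def)
  then show "N \<union> {e \<in> M. e \<inter> S \<noteq> {}} \<subseteq> edges G" using M by (auto simp: perfect_matching_def)
  fix v assume v: "v \<in> verts G"
  show "\<exists>!e. e \<in> N \<union> {e \<in> M. e \<inter> S \<noteq> {}} \<and> v \<in> e"
  proof (cases "v \<in> S")
    case True
    have "\<exists>!e. e \<in> M \<and> v \<in> e" using M v by (auto simp: perfect_matching_def)
    moreover have eq: "e \<in> N \<union> {e \<in> M. e \<inter> S \<noteq> {}} \<and> v \<in> e \<longleftrightarrow> e \<in> M \<and> v \<in> e" for e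
      using True NE by auto
    ultimately show ?thesis unfolding eq by blast
  next
    case False
    then have "\<exists>!e. e \<in> N \<and> v \<in> e" using N v by (auto simp: perfect_matching_def delete_verts_def)
    moreover have eq: "e \<in> N \<union> {e \<in> M. e \<inter> S \<noteq> {}} \<and> v \<in> e \<longleftrightarrow> e \<in> N \<and> v \<in> e" for e
      using False closed[of e] by auto
    ultimately show ?thesis unfolding eq by blast
  qed
qed

theorem theorem3p2:
  fixes H :: grid_graph and K :: "(real \<times> real) set set"
  assumes "polyomino_graph H"
    and "\<exists>M. perfect_matching H M"
    and "maximal_alternating_set H K"
  shows "\<exists>!M. perfect_matching (delete_faces H K) M"
proof -
  note H = assms(1)
  have sub: "grid_subgraph H" using H by (simp add: polyomino_graph_def)
  have KF: "K \<subseteq> finite_faces H"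
    using assms(3) by (simp add: maximal_alternating_set_def alternating_set_def)
  obtain M where M: "perfect_matching H M" and res: "\<And>F. F \<in> K \<Longrightarrow> resonant H M F"
    using assms(3) by (auto simp: maximal_alternating_set_def alternating_set_def)
  define S where "S = {v \<in> verts H. \<exists>F\<in>K. pt v \<in> frontier F}"
  have closed: "e \<subseteq> S" if e: "e \<in> M" "e \<inter> S \<noteq> {}" for e
  proof
    fix u assume u: "u \<in> e"
    obtain v F where v: "v \<in> e" "v \<in> verts H" "F \<in> K" "pt v \<in> frontier F"
      using e(2) by (auto simp: S_def)
    have "pt u \<in> frontier F"
      using resonant_face_matched[OF H M _ res v(2,4) e(1) v(1) u] v(3) KF by blast
    moreover have "u \<in> verts H"
      using u e(1) M edge_subset_verts[OF sub] by (auto simp: perfect_matching_def)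
    ultimately show "u \<in> S" using v(3) by (auto simp: S_def)
  qed
  have del: "delete_faces H K = delete_verts H S" by (simp add: delete_faces_def S_def)
  define ext where "ext N = N \<union> {e \<in> M. e \<inter> S \<noteq> {}}" for N
  have extPM: "perfect_matching H (ext N)" if "perfect_matching (delete_verts H S) N" for N
    unfolding ext_def using perfect_matching_extend[OF M closed that] .
  have NE: "e \<inter> S = {}" if "perfect_matching (delete_verts H S) N" "e \<in> N" for N e
    using that by (auto simp: perfect_matching_def delete_verts_def)
  have ext_res: "resonant H (ext N) F"
    if N: "perfect_matching (delete_verts H S) N" and F: "F \<in> K" for N F
  proof -
    obtain xs where xs: "cycle_edges xs = boundary_edges H F" "alternating_cycle H M xs"
      using res[OF F] by (auto simp: resonant_def)
    \<comment> \<open>Boundary edges of a face in \<open>K\<close> meet \<open>S\<close>, and there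
      every extension copies \<open>M\<close>.\<close>
    have "e \<in> ext N \<longleftrightarrow> e \<in> M" if "e \<in> cycle_edges xs" for e
    proof -
      have "e \<in> edges H" "edge_seg e \<subseteq> frontier F" using that xs by (auto simp: boundary_edges_def)
      moreover obtain u v where "e = {u, v}" "u \<in> verts H"
        using \<open>e \<in> edges H\<close> sub by (auto simp: grid_subgraph_def)
      moreover have "pt u \<in> edge_seg e" using \<open>e = {u, v}\<close> by (auto simp: edge_seg_def intro: hull_inc)
      ultimately have "e \<inter> S \<noteq> {}" using F by (auto simp: S_def)
      then show ?thesis using NE[OF N, of e] by (auto simp: ext_def)
    qed
    moreover have "cycle_edge xs k \<in> cycle_edges xs" for k
    proof -
      have "length xs > 0" using xs(2) by (auto simp: alternating_cycle_def is_cycle_def)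
      moreover have "cycle_edge xs k = cycle_edge xs (k mod length xs)"
        by (simp add: cycle_edge_def mod_Suc_eq)
      ultimately show ?thesis by (simp add: cycle_edges_def)
    qed
    ultimately have "alternating_cycle H (ext N) xs" using xs(2) by (simp add: alternating_cycle_def)
    then show ?thesis using xs(1) by (auto simp: resonant_def)
  qed
  have uniq: "N1 = N2"
    if N1: "perfect_matching (delete_verts H S) N1" and N2: "perfect_matching (delete_verts H S) N2"
    for N1 N2
  proof (rule ccontr)
    assume "N1 \<noteq> N2"
    \<comment> \<open>\<open>N\<close> is recovered from \<open>ext N\<close>, so distinct matchings
      have distinct extensions.\<close>
    moreover have "N1 = {e \<in> ext N1. e \<inter> S = {}}" "N2 = {e \<in> ext N2. e \<inter> S = {}}"
      using NE[OF N1] NE[OF N2] by (auto simp: ext_def)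
    ultimately have "ext N1 \<noteq> ext N2" by metis
    then obtain F v e where F: "F \<in> finite_faces H" "resonant H (ext N1) F \<or> resonant H (ext N2) F"
      and v: "v \<in> verts H" "pt v \<in> frontier F" "v \<in> e" "(e \<in> ext N1) \<noteq> (e \<in> ext N2)"
      by (rule two_matchings_resonant_face[OF H extPM[OF N1] extPM[OF N2]])
    \<comment> \<open>If \<open>F\<close> were in \<open>K\<close>, then \<open>v\<close> would be
      in \<open>S\<close>; but the extensions agree on all edges that meet \<open>S\<close>.\<close>
    have "F \<notin> K"
    proof
      assume "F \<in> K"
      then have "e \<inter> S \<noteq> {}" using v by (auto simp: S_def)
      then show False using v(4) NE[OF N1, of e] NE[OF N2, of e] by (auto simp: ext_def)
    qed
    \<comment> \<open>Whichever extension makes \<open>F\<close> resonant keeps all faces of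
      \<open>K\<close> resonant, so \<open>F\<close> can be added to \<open>K\<close>, against
      maximality.\<close>
    moreover obtain N where N: "perfect_matching (delete_verts H S) N" "resonant H (ext N) F"
      using F(2) N1 N2 by blast
    have "alternating_set H (insert F K)"
      unfolding alternating_set_def
      using KF F(1) N(2) ext_res[OF N(1)] extPM[OF N(1)] by blast
    ultimately show False using assms(3) unfolding maximal_alternating_set_def by blast
  qed
  show ?thesis
    unfolding del using perfect_matching_delete_verts[OF M closed] uniq by blast
qed

end
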